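(* Let $n\ge 2$. There exist nonempty sets $\mathcal S_1,\mathcal S_2,\mathcal S_3\subset\mathbb{R}^4$ of coefficients $(A,B,C,D)$, each having a given geometric characteristic, such that for every $(A,B,C,D)\in\mathcal S_1\cup\mathcal S_2\cup\mathcal S_3$ the $CB_n$-invariant polynomial $$f(x_1,\dots,x_n)=A\sum_{1\le i<j\le n}x_i^2x_j^2+B\Big(\sum_{i=1}^n x_i^2\Big)^2+C\sum_{i=1}^n x_i^2+D$$ has degree four, and, writing $Z(f)=\{x\in\mathbb{R}^n : f(x)=0\}$: \begin{enumerate} \item the maximal number of connected components of $Z(f)$, for $(A,B,C,D)\in\mathcal S_1$, is $2^n+1$; \item the maximal number of compact connected components of $Z(f)$, for $(A,B,C,D)\in\mathcal S_2$, is $2^n$; \item the maximal number of nested compact connected components of $Z(f)$, for $(A,B,C,D)\in\mathcal S_3$, is $2$. \end{enumerate}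
   Context: $CB_n$ is the hyperoctahedral group: the group of $n\times n$ monomial matrices with nonzero entries in $\{-1,1\}$, acting on $V=\mathbb{R}^n$. $\mathbb{R}[V]^{CB_n}$ is the algebra of real polynomials on $V$ invariant under this action. Every polynomial of degree four in $\mathbb{R}[V]^{CB_n}$ has the form $A\sigma_2+B\sigma_1^2+C\sigma_1+D$ with $(A,B,C,D)\in\mathbb{R}^4$, where $\sigma_1=\sum_i x_i^2$ and $\sigma_2=\sum_{i<j}x_i^2x_j^2$. A set of polynomials (equivalently, of coefficient vectors in $\mathbb{R}^4$) has a given geometric characteristic if it is connected and the zero loci in $\mathbb{R}^n$ of any two of its polynomials are equivalent up to isotopy in $\mathbb{R}^n$ (that is, their collections of connected components are). Nested compact connected components are concentric (with common center the origin, each lying in the bounded region enclosed by the next), pairwise disjoint compact connected components which together are isomorphic (homeomorphic) to a family of disjoint concentric $(n-1)$-spheres. The number of nested compact connected components of $Z(f)$ is the largest number of components in such a family. Connected components are taken for the topology induced from the Euclidean topology of $\mathbb{R}^n$. *)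

theory Defs
  imports
    "HOL-Analysis.Analysis"
    "HOL-Library.Poly_Mapping"
    "HOL-Library.Extended_Nat"
begin

section \<open>Real polynomials in the coordinates of \<open>real ^ 'n\<close>\<close>

type_synonym 'n monomial = "('n, nat) poly_mapping"

type_synonym 'n polynomial = "('n monomial, real) poly_mapping"

definition Var :: "'n \<Rightarrow> 'n polynomial" where
  "Var i = Poly_Mapping.single (Poly_Mapping.single i 1) 1"

definition Const :: "real \<Rightarrow> 'n polynomial" where
  "Const c = Poly_Mapping.single 0 c"

definition peval :: "'n::finite polynomial \<Rightarrow> real ^ 'n \<Rightarrow> real" where
  "peval p x =
     (\<Sum>m\<in>Poly_Mapping.keys p.
        Poly_Mapping.lookup p m * (\<Prod>i\<in>UNIV. (x $ i) ^ Poly_Mapping.lookup m i))"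

text \<open>The zero polynomial gets total degree 0.\<close>

definition total_degree :: "'n::finite polynomial \<Rightarrow> nat" where
  "total_degree p =
     Max (insert 0 ((\<lambda>m. \<Sum>i\<in>UNIV. Poly_Mapping.lookup m i) ` Poly_Mapping.keys p))"

definition zero_locus :: "'n::finite polynomial \<Rightarrow> (real ^ 'n) set" where
  "zero_locus p = {x. peval p x = 0}"


section \<open>The hyperoctahedral group and the quartic invariants\<close>

definition CB :: "(real ^ 'n ^ 'n) set" where
  "CB = {M. (\<forall>i. \<exists>!j. M $ i $ j \<noteq> 0) \<and> (\<forall>j. \<exists>!i. M $ i $ j \<noteq> 0) \<and>
            (\<forall>i j. M $ i $ j \<noteq> 0 \<longrightarrow> M $ i $ j \<in> {-1, 1})}"

text \<open>Invariance is expressed through values; over an infinite field this is the same as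
  invariance of the formal polynomial.\<close>

definition CB_invariant :: "'n::finite polynomial \<Rightarrow> bool" where
  "CB_invariant p \<longleftrightarrow> (\<forall>M\<in>CB. \<forall>x. peval p (M *v x) = peval p x)"

definition sigma1 :: "'n::finite polynomial" where
  "sigma1 = (\<Sum>i\<in>UNIV. Var i ^ 2)"

definition sigma2 :: "'n::{finite,linorder} polynomial" where
  "sigma2 = (\<Sum>(i, j)\<in>{(i, j). i < j}. Var i ^ 2 * Var j ^ 2)"


section \<open>Geometric characteristic\<close>

text \<open>Ambient isotopy: a path of self-homeomorphisms of the space, starting at the identity, whose
  end carries \<open>X\<close> onto \<open>Y\<close>. Being a homeomorphism, the end map then also carries the collection of
  connected components of \<open>X\<close> onto that of \<open>Y\<close>.\<close>

definition isotopic :: "'a::topological_space set \<Rightarrow> 'a set \<Rightarrow> bool" where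
  "isotopic X Y \<longleftrightarrow>
     (\<exists>h. homotopic_with_canon (\<lambda>h. \<exists>k. homeomorphism UNIV UNIV h k) UNIV UNIV id h \<and> h ` X = Y)"

definition geometric_characteristic ::
    "('c::topological_space \<Rightarrow> 'n::finite polynomial) \<Rightarrow> 'c set \<Rightarrow> bool" where
  "geometric_characteristic f S \<longleftrightarrow>
     connected S \<and> (\<forall>p\<in>S. \<forall>q\<in>S. isotopic (zero_locus (f p)) (zero_locus (f q)))"


section \<open>Numbers of connected components\<close>

text \<open>Numbers are taken in \<open>enat\<close> because \<open>card\<close> is 0 on infinite sets.\<close>

definition ecard :: "'a set \<Rightarrow> enat" where
  "ecard X = (if finite X then enat (card X) else \<infinity>)"

definition num_components :: "'a::topological_space set \<Rightarrow> enat" where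
  "num_components Z = ecard (components Z)"

definition num_compact_components :: "'a::topological_space set \<Rightarrow> enat" where
  "num_compact_components Z = ecard {C \<in> components Z. compact C}"

text \<open>A family of compact components, all enclosing the origin, that is matched by one
  homeomorphism \<open>h\<close> of the unions, component by component, with the disjoint concentric spheres
  of radii \<open>\<rho> C\<close>; the components are ordered by these radii, and each lies in the bounded region
  enclosed by any later one. Disjointness is automatic for components.\<close>

definition nested_components :: "'a::euclidean_space set \<Rightarrow> 'a set set \<Rightarrow> bool" where
  "nested_components Z \<N> \<longleftrightarrow>
     \<N> \<subseteq> components Z \<and>
     (\<forall>C\<in>\<N>. compact C \<and> 0 \<in> inside C) \<and>
     (\<exists>\<rho> :: 'a set \<Rightarrow> real. inj_on \<rho> \<N> \<and> (\<forall>C\<in>\<N>. 0 < \<rho> C) \<and>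
        (\<forall>C\<in>\<N>. \<forall>D\<in>\<N>. \<rho> C < \<rho> D \<longrightarrow> C \<subseteq> inside D) \<and>
        (\<exists>h k. homeomorphism (\<Union>\<N>) (\<Union>C\<in>\<N>. sphere (0::'a) (\<rho> C)) h k \<and>
               (\<forall>C\<in>\<N>. h ` C = sphere 0 (\<rho> C))))"

definition num_nested_components :: "'a::euclidean_space set \<Rightarrow> enat" where
  "num_nested_components Z = (SUP \<N>\<in>{\<N>. nested_components Z \<N>}. ecard \<N>)"

definition is_maximum_on :: "('c \<Rightarrow> 'b::order) \<Rightarrow> 'c set \<Rightarrow> 'b \<Rightarrow> bool" where
  "is_maximum_on N S m \<longleftrightarrow> (\<exists>p\<in>S. N p = m) \<and> (\<forall>p\<in>S. N p \<le> m)"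

end

(*
  Singletons S1, S2, S3 suffice. Write s for the sum of the squares and q for the sum of the fourth
  powers of the coordinates, so that 2 sigma2 = s^2 - q.
  For S1 take f = s^2 - (n - 1) q - s. The origin is an isolated zero. A zero with a vanishing
  coordinate has s^2 <= (n - 1) q by Cauchy-Schwarz, hence s <= 0; so every other zero lies in an open
  orthant. In the coordinates y_i = x_i^2 the condition s^2 > (n - 1) q describes a convex cone, and
  each of its rays meets f = 0 exactly once, so each orthant contributes one connected sheet.
  For S2 take f = q - 2 s + n, the sum of the (x_i^2 - 1)^2, whose zeros are the 2^n sign vectors.
  For S3 take f = (s - 1) (s - 4), whose zero set is a pair of concentric spheres.
*)
theory Submission
  imports Defs "HOL-Computational_Algebra.Polynomial"
begin

section \<open>Evaluation and degree\<close>

definition meval :: "'n::finite monomial \<Rightarrow> real ^ 'n \<Rightarrow> real" where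
  "meval m x = (\<Prod>i\<in>UNIV. (x $ i) ^ Poly_Mapping.lookup m i)"

definition mdegree :: "'n::finite monomial \<Rightarrow> nat" where
  "mdegree m = (\<Sum>i\<in>UNIV. Poly_Mapping.lookup m i)"

lemma meval_add: "meval (m + m') x = meval m x * meval m' x"
  by (simp add: meval_def lookup_add power_add prod.distrib)

lemma meval_scaleR: "meval m (t *\<^sub>R x) = t ^ mdegree m * meval m x"
  by (simp add: meval_def mdegree_def power_mult_distrib prod.distrib power_sum)

lemma mdegree_add: "mdegree (m + m') = mdegree m + mdegree m'"
  by (simp add: mdegree_def lookup_add sum.distrib)

lemma mdegree_0: "mdegree 0 = 0"
  by (simp add: mdegree_def)

lemma mdegree_single: "mdegree (Poly_Mapping.single i k) = k"
  by (simp add: mdegree_def lookup_single when_def)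

text \<open>Padding with zero coefficients puts two polynomials over a common index set, so
  additivity of evaluation can be checked term by term.\<close>

lemma peval_superset:
  assumes "finite K" "Poly_Mapping.keys p \<subseteq> K"
  shows "peval p x = (\<Sum>m\<in>K. Poly_Mapping.lookup p m * meval m x)"
  unfolding peval_def meval_def [symmetric]
  using assms by (intro sum.mono_neutral_left) (auto simp: in_keys_iff)

lemma peval_0: "peval 0 x = 0"
  by (simp add: peval_def)

lemma peval_add: "peval (p + q) x = peval p x + peval q x"
proof -
  let ?K = "Poly_Mapping.keys p \<union> Poly_Mapping.keys q"
  have "peval r x = (\<Sum>m\<in>?K. Poly_Mapping.lookup r m * meval m x)"
    if "Poly_Mapping.keys r \<subseteq> ?K" for r
    using that by (intro peval_superset) auto
  then show ?thesis
    by (simp add: keys_add lookup_add distrib_right sum.distrib)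
qed

lemma peval_sum: "peval (sum p I) x = (\<Sum>i\<in>I. peval (p i) x)"
  by (induction I rule: infinite_finite_induct) (simp_all add: peval_0 peval_add)

lemma peval_single: "peval (Poly_Mapping.single m c) x = c * meval m x"
  by (subst peval_superset [of "{m}"]) auto

lemma poly_mapping_eq_sum_single:
  "p = (\<Sum>m\<in>Poly_Mapping.keys p. Poly_Mapping.single m (Poly_Mapping.lookup p m))"
  by (rule poly_mapping_eqI) (auto simp: lookup_sum lookup_single when_def in_keys_iff)

lemma peval_mult: "peval (p * q) x = peval p x * peval q x"
proof -
  have "peval (p * q) x = peval ((\<Sum>m\<in>Poly_Mapping.keys p. Poly_Mapping.single m (Poly_Mapping.lookup p m)) *
      (\<Sum>m\<in>Poly_Mapping.keys q. Poly_Mapping.single m (Poly_Mapping.lookup q m))) x"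
    by (simp flip: poly_mapping_eq_sum_single)
  also have "\<dots> = peval (\<Sum>m\<in>Poly_Mapping.keys p. Poly_Mapping.single m (Poly_Mapping.lookup p m)) x *
      peval (\<Sum>m\<in>Poly_Mapping.keys q. Poly_Mapping.single m (Poly_Mapping.lookup q m)) x"
    by (simp add: sum_product peval_sum mult_single peval_single meval_add mult_ac)
  finally show ?thesis
    by (simp flip: poly_mapping_eq_sum_single)
qed

lemma peval_Const: "peval (Const c) x = c"
  by (simp add: Const_def peval_single meval_def)

lemma peval_power2: "peval (p ^ 2) x = (peval p x) ^ 2"
  by (simp add: power2_eq_square peval_mult)

lemma peval_Var: "peval (Var i) x = x $ i"
proof -
  have "(\<Prod>j\<in>UNIV. (x $ j) ^ Poly_Mapping.lookup (Poly_Mapping.single i (Suc 0)) j) =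
      (\<Prod>j\<in>UNIV. if j = i then x $ j else 1)"
    by (rule prod.cong) (auto simp: lookup_single when_def)
  then show ?thesis
    by (simp add: Var_def peval_single meval_def)
qed

section \<open>Bounds for the total degree\<close>

lemma total_degree_le_iff:
  "total_degree p \<le> d \<longleftrightarrow> (\<forall>m\<in>Poly_Mapping.keys p. mdegree m \<le> d)"
  by (simp add: total_degree_def mdegree_def)

lemma total_degree_add:
  assumes "total_degree p \<le> d" "total_degree q \<le> d"
  shows "total_degree (p + q) \<le> d"
  using assms keys_add [of p q] by (auto simp: total_degree_le_iff)

lemma total_degree_sum:
  assumes "\<And>i. i \<in> I \<Longrightarrow> total_degree (p i) \<le> d"
  shows "total_degree (sum p I) \<le> d"
  using assms
  by (induction I rule: infinite_finite_induct) (auto intro: total_degree_add simp: total_degree_le_iff [of 0])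

lemma total_degree_mult:
  assumes "total_degree p \<le> d" "total_degree q \<le> e"
  shows "total_degree (p * q) \<le> d + e"
  using assms keys_mult [of p q] by (fastforce simp: total_degree_le_iff mdegree_add intro: add_mono)

lemma total_degree_Const: "total_degree (Const c) \<le> d"
  by (simp add: total_degree_le_iff Const_def mdegree_0)

lemma total_degree_Var: "total_degree (Var i) \<le> 1"
  by (simp add: total_degree_le_iff Var_def mdegree_single)

text \<open>Restricting to a line through the origin bounds the total degree from below.\<close>

lemma degree_le_total_degree:
  assumes "\<And>t. peval p (t *\<^sub>R v) = poly q t"
  shows "degree q \<le> total_degree p"
proof -
  \<comment> \<open>\<open>r\<close> is \<open>p\<close> along the line through \<open>v\<close>: a
    monomial \<open>m\<close> becomes a multiple of \<open>t ^ mdegree m\<close>. Real polynomials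
    with equal values are equal, hence \<open>r = q\<close>.\<close>
  define r where "r = (\<Sum>m\<in>Poly_Mapping.keys p.
    monom (Poly_Mapping.lookup p m * meval m v) (mdegree m))"
  have "poly r t = poly q t" for t
    using peval_superset [of "Poly_Mapping.keys p" p "t *\<^sub>R v"]
    by (simp add: r_def poly_sum poly_monom meval_scaleR mult_ac flip: assms)
  then have "r = q"
    by (simp add: poly_eq_poly_eq_iff [symmetric] fun_eq_iff)
  moreover have "degree r \<le> total_degree p"
    unfolding r_def
    using total_degree_le_iff [of p "total_degree p"]
    by (intro degree_sum_le) (auto intro: order_trans [OF degree_monom_le])
  ultimately show ?thesis by simp
qed

section \<open>The quartic invariants\<close>

definition invariant_quartic ::
    "real \<times> real \<times> real \<times> real \<Rightarrow> 'n::{finite,linorder} polynomial" where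
  "invariant_quartic = (\<lambda>(A, B, C, D).
     Const A * sigma2 + Const B * sigma1 ^ 2 + Const C * sigma1 + Const D)"

text \<open>\<open>psum 2\<close> and \<open>psum 4\<close> are the \<open>s\<close> and
  \<open>q\<close> of the overview; \<open>psum 1\<close> serves when the squared coordinates become
  the variables.\<close>

definition psum :: "nat \<Rightarrow> real ^ 'n::finite \<Rightarrow> real" where
  "psum k x = (\<Sum>i\<in>UNIV. (x $ i) ^ k)"

lemma psum_scaleR: "psum k (t *\<^sub>R x) = t ^ k * psum k x"
  by (simp add: psum_def power_mult_distrib sum_distrib_left)

lemma psum_2_eq_norm: "psum 2 x = (norm x)\<^sup>2"
  by (simp add: psum_def norm_vec_def L2_set_def sum_nonneg)

text \<open>The square expands over all ordered pairs; swapping the entries identifies the two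
  off-diagonal triangles.\<close>

lemma square_sum_eq:
  fixes y :: "'n::{finite,linorder} \<Rightarrow> real"
  shows "(sum y UNIV)\<^sup>2 = (\<Sum>i\<in>UNIV. (y i)\<^sup>2) + 2 * (\<Sum>(i, j)\<in>{(i, j). i < j}. y i * y j)"
proof -
  let ?L = "{(i, j). i < j} :: ('n \<times> 'n) set" and ?G = "{(i, j). j < i} :: ('n \<times> 'n) set"
  have U: "(UNIV :: ('n \<times> 'n) set) = (\<lambda>i. (i, i)) ` UNIV \<union> (?L \<union> ?G)"
    by auto
  have "(sum y UNIV)\<^sup>2 = (\<Sum>(i, j)\<in>UNIV. y i * y j)"
    by (simp add: power2_eq_square sum_product sum.cartesian_product)
  also have "\<dots> = (\<Sum>(i, j)\<in>(\<lambda>i. (i, i)) ` UNIV. y i * y j) +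
      ((\<Sum>(i, j)\<in>?L. y i * y j) + (\<Sum>(i, j)\<in>?G. y i * y j))"
    by (subst U, subst sum.union_disjoint; (subst sum.union_disjoint)?) auto
  also have "(\<Sum>(i, j)\<in>?G. y i * y j) = (\<Sum>(i, j)\<in>?L. y i * y j)"
    by (rule sum.reindex_bij_witness [of _ prod.swap prod.swap]) (auto simp: mult.commute)
  also have "(\<Sum>(i, j)\<in>(\<lambda>i. (i, i)) ` UNIV. y i * y j) = (\<Sum>i\<in>UNIV. (y i)\<^sup>2)"
    by (subst sum.reindex) (auto simp: inj_on_def power2_eq_square)
  finally show ?thesis by simp
qed

lemma peval_sigma1: "peval sigma1 x = psum 2 x"
  by (simp add: sigma1_def peval_sum peval_power2 peval_Var psum_def)

lemma peval_sigma2: "peval sigma2 x = ((psum 2 x)\<^sup>2 - psum 4 x) / 2"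
proof -
  have "peval sigma2 x = (\<Sum>(i, j)\<in>{(i, j). i < j}. (x $ i)\<^sup>2 * (x $ j)\<^sup>2)"
    by (simp add: sigma2_def peval_sum peval_mult peval_power2 peval_Var case_prod_unfold)
  then show ?thesis
    using square_sum_eq [of "\<lambda>i. (x $ i)\<^sup>2"] by (simp add: psum_def flip: power_mult)
qed

lemma peval_invariant_quartic:
  "peval (invariant_quartic (A, B, C, D)) x =
     A * ((psum 2 x)\<^sup>2 - psum 4 x) / 2 + B * (psum 2 x)\<^sup>2 + C * psum 2 x + D"
  by (simp add: invariant_quartic_def peval_add peval_mult peval_power2 peval_Const
      peval_sigma1 peval_sigma2)

section \<open>Invariance under the hyperoctahedral group\<close>

text \<open>A matrix in \<open>CB\<close> permutes the coordinates up to sign, and even powers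
  forget the sign.\<close>

lemma psum_CB:
  assumes "M \<in> CB" "even k" "0 < k"
  shows "psum k (M *v x) = psum k x"
proof -
  have row: "\<exists>!j. M $ i $ j \<noteq> 0" and col: "\<exists>!j. M $ j $ i \<noteq> 0"
    and sgn: "M $ i $ j \<noteq> 0 \<Longrightarrow> M $ i $ j \<in> {-1, 1}" for i j
    using assms(1) by (auto simp: CB_def)
  from row obtain \<pi> where \<pi>: "\<And>i. M $ i $ \<pi> i \<noteq> 0" "\<And>i j. M $ i $ j \<noteq> 0 \<Longrightarrow> j = \<pi> i"
    by metis
  \<comment> \<open>The unique nonzero entry of each column makes \<open>\<pi>\<close> both
    injective and surjective.\<close>
  have "bij \<pi>"
    unfolding bij_def inj_def surj_def using \<pi> col by metis
  have "(M *v x) $ i = M $ i $ \<pi> i * x $ \<pi> i" for i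
  proof -
    have "(M *v x) $ i = (\<Sum>j\<in>UNIV. if j = \<pi> i then M $ i $ j * x $ j else 0)"
      unfolding matrix_vector_mult_def vec_lambda_beta
      by (intro sum.cong) (use \<pi>(2) in auto)
    then show ?thesis by simp
  qed
  then have "((M *v x) $ i) ^ k = (x $ \<pi> i) ^ k" for i
    using sgn [OF \<pi>(1), of i] \<open>even k\<close> by (auto simp: power_mult_distrib)
  then have "psum k (M *v x) = (\<Sum>i\<in>UNIV. (x $ \<pi> i) ^ k)"
    by (simp add: psum_def)
  also have "\<dots> = psum k x"
    unfolding psum_def using \<open>bij \<pi>\<close> by (intro sum.reindex_bij_betw)
  finally show ?thesis .
qed

lemma CB_invariant_invariant_quartic: "CB_invariant (invariant_quartic p)"
  by (cases p) (simp add: CB_invariant_def peval_invariant_quartic psum_CB)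

section \<open>The degree is exactly four\<close>

lemma total_degree_invariant_quartic_le:
  "total_degree (invariant_quartic p :: 'n::{finite,linorder} polynomial) \<le> 4"
proof -
  have *: "total_degree (p * q) \<le> 4" if "total_degree p \<le> d" "total_degree q \<le> e" "d + e \<le> 4"
    for p q :: "'n polynomial" and d e
    using total_degree_mult [OF that(1,2)] that(3) by simp
  have V: "total_degree (Var i ^ 2) \<le> 2" for i :: 'n
    using total_degree_mult [OF total_degree_Var total_degree_Var, of i i]
    by (simp add: power2_eq_square)
  have 1: "total_degree (sigma1 :: 'n polynomial) \<le> 2"
    unfolding sigma1_def by (intro total_degree_sum V)
  have 2: "total_degree (sigma2 :: 'n polynomial) \<le> 4"
    unfolding sigma2_def by (intro total_degree_sum) (auto intro: * V)
  have 3: "total_degree (sigma1 ^ 2 :: 'n polynomial) \<le> 4"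
    unfolding power2_eq_square by (rule * [OF 1 1]) simp
  show ?thesis
    unfolding invariant_quartic_def
    by (cases p) (auto intro!: total_degree_add * [OF total_degree_Const [of _ 0]] total_degree_Const 1 2 3)
qed

text \<open>Along the line through \<open>v\<close> the coefficient of \<open>t ^ 4\<close> is the
  quantity assumed nonzero, so the degree is at least four.\<close>

lemma total_degree_invariant_quartic:
  fixes v :: "real ^ 'n::{finite,linorder}"
  assumes "A * ((psum 2 v)\<^sup>2 - psum 4 v) / 2 + B * (psum 2 v)\<^sup>2 \<noteq> 0"
  shows "total_degree (invariant_quartic (A, B, C, D) :: 'n polynomial) = 4"
proof (rule antisym [OF total_degree_invariant_quartic_le])
  define c where "c = A * ((psum 2 v)\<^sup>2 - psum 4 v) / 2 + B * (psum 2 v)\<^sup>2"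
  have "peval (invariant_quartic (A, B, C, D)) (t *\<^sub>R v) = poly [:D, 0, C * psum 2 v, 0, c:] t" for t
    unfolding peval_invariant_quartic psum_scaleR c_def
    by (simp add: field_simps eval_nat_numeral)
  from degree_le_total_degree [OF this] show "4 \<le> total_degree (invariant_quartic (A, B, C, D) :: 'n polynomial)"
    using assms by (simp add: c_def [symmetric])
qed

section \<open>Components\<close>

lemma isotopic_refl: "isotopic X X"
  unfolding isotopic_def
  by (rule exI [of _ id]) (use homeomorphism_ident in \<open>auto simp: id_def\<close>)

text \<open>A singleton only asks that one zero locus be isotopic to itself; hence single
  coefficient vectors can serve as the three sets.\<close>

lemma geometric_characteristic_singleton: "geometric_characteristic f {p}"
  by (simp add: geometric_characteristic_def isotopic_refl)

text \<open>The complement of a block is a union of other blocks, hence also open, so a connected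
  subset meeting a block stays inside it. The blocks are thus the maximal connected subsets.\<close>

lemma components_eq_open_partition:
  assumes "\<Union>F = Z" "pairwise disjnt F"
    and F: "\<And>A. A \<in> F \<Longrightarrow> A \<noteq> {} \<and> connected A \<and> openin (top_of_set Z) A"
  shows "components Z = F"
proof -
  have *: "C \<subseteq> A" if "A \<in> F" "C \<subseteq> Z" "connected C" "C \<inter> A \<noteq> {}" for A C
  proof -
    have "Z - A = \<Union>(F - {A})"
      using assms(1,2) \<open>A \<in> F\<close> by (auto simp: pairwise_def disjnt_def)
    then have "openin (top_of_set Z) (Z - A)"
      using F by auto
    then have "openin (top_of_set C) (C \<inter> (Z - A))" "openin (top_of_set C) (C \<inter> A)"
      using F [OF \<open>A \<in> F\<close>] \<open>C \<subseteq> Z\<close>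
      by (metis inf.commute openin_open inf.absorb_iff2 inf_assoc)+
    moreover have "C \<subseteq> C \<inter> A \<union> C \<inter> (Z - A)"
      using \<open>C \<subseteq> Z\<close> by auto
    ultimately show ?thesis
      using \<open>connected C\<close> \<open>C \<inter> A \<noteq> {}\<close> \<open>C \<subseteq> Z\<close> unfolding connected_openin by blast
  qed
  show ?thesis
  proof (intro equalityI subsetI)
    fix C assume "C \<in> components Z"
    then have C: "C \<noteq> {}" "C \<subseteq> Z" "connected C"
      and max: "\<And>D. D \<noteq> {} \<Longrightarrow> C \<subseteq> D \<Longrightarrow> D \<subseteq> Z \<Longrightarrow> connected D \<Longrightarrow> D = C"
      by (auto simp: in_components_maximal)
    obtain A where A: "A \<in> F" "C \<inter> A \<noteq> {}"
      using C \<open>\<Union>F = Z\<close> by blast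
    with * C have "C \<subseteq> A" by blast
    then have "A = C"
      using max F A \<open>\<Union>F = Z\<close> by blast
    with A show "C \<in> F" by simp
  next
    fix A assume "A \<in> F"
    then show "A \<in> components Z"
      unfolding in_components_maximal using F * \<open>\<Union>F = Z\<close> by blast
  qed
qed

text \<open>A sphere is the frontier of a ball and encloses exactly its interior. This supplies the
  nesting conditions.\<close>

lemma cball_subset_inside_sphere:
  assumes "0 < s" "r < s" "2 \<le> DIM('a::euclidean_space)"
  shows "cball (0::'a) r \<subseteq> inside (sphere 0 s)"
proof -
  have "inside (frontier (cball (0::'a) s)) = interior (cball 0 s)"
    using assms(3) by (intro inside_frontier_eq_interior) simp_all
  then have "inside (sphere (0::'a) s) = ball 0 s"
    by (simp add: frontier_cball interior_cball)
  then show ?thesis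
    using assms(2) by (simp add: subset_eq)
qed

text \<open>A sign vector is encoded by the set of its positive coordinates, so sign vectors and
  orthants are counted as subsets of the index type.\<close>

definition sign_vec :: "'n::finite set \<Rightarrow> real ^ 'n" where
  "sign_vec T = (\<chi> i. if i \<in> T then 1 else -1)"

lemma inj_sign_vec: "inj sign_vec"
  by (rule injI) (auto simp: sign_vec_def vec_eq_iff split: if_splits)

lemma card_sets: "card (UNIV :: 'n::finite set set) = 2 ^ CARD('n)"
  using card_Pow [of "UNIV :: 'n set"] by simp

lemma enat_two_power: "enat (2 ^ k) = 2 ^ k"
  by (metis of_nat_eq_enat of_nat_numeral of_nat_power)

text \<open>In a T1 space the complement of finitely many points is open, so a finite
  \<open>Z\<close> is discrete.\<close>

lemma components_finite:
  fixes Z :: "'a::t1_space set"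
  assumes "finite Z"
  shows "components Z = (\<lambda>x. {x}) ` Z"
proof (rule components_eq_open_partition)
  fix A assume "A \<in> (\<lambda>x. {x}) ` Z"
  then obtain x where x: "x \<in> Z" "A = {x}" by auto
  then have "A = Z \<inter> - (Z - {x})" by auto
  moreover have "open (- (Z - {x}))"
    using assms by (intro open_Compl finite_imp_closed) auto
  ultimately show "A \<noteq> {} \<and> connected A \<and> openin (top_of_set Z) A"
    using x by (auto simp: openin_open)
qed (auto simp: pairwise_def disjnt_def)

section \<open>Isolated points\<close>

text \<open>As \<open>2 sigma2 = s^2 - q\<close>, taking \<open>A = - 2\<close> and
  \<open>B = 1\<close> cancels \<open>s^2\<close> and leaves \<open>q - 2 s + n\<close>. In this sum
  of squares every summand must vanish.\<close>

lemma zero_locus_signs: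
  "zero_locus (invariant_quartic (- 2, 1, - 2, real CARD('n)) :: 'n::{finite,linorder} polynomial) =
     range sign_vec"
proof -
  have "peval (invariant_quartic (- 2, 1, - 2, real CARD('n))) x = (\<Sum>i\<in>UNIV. ((x $ i)\<^sup>2 - 1)\<^sup>2)"
    for x :: "(real, 'n) vec"
  proof -
    have "(\<Sum>i\<in>UNIV. ((x $ i)\<^sup>2 - 1)\<^sup>2) = (\<Sum>i\<in>UNIV. (x $ i) ^ 4 - 2 * (x $ i)\<^sup>2 + 1)"
      by (intro sum.cong) (simp_all add: power2_diff flip: power_mult)
    then show ?thesis
      unfolding peval_invariant_quartic
      by (simp add: psum_def sum.distrib sum_subtractf field_simps flip: sum_distrib_left)
  qed
  then have Z: "x \<in> zero_locus (invariant_quartic (- 2, 1, - 2, real CARD('n))) \<longleftrightarrow> (\<forall>i. x $ i = 1 \<or> x $ i = - 1)"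
    for x :: "(real, 'n) vec"
    by (simp add: zero_locus_def sum_nonneg_eq_0_iff power2_eq_1_iff)
  moreover have "x = sign_vec {i. x $ i = 1}" if "\<forall>i. x $ i = 1 \<or> x $ i = - 1" for x :: "(real, 'n) vec"
    using that by (auto simp: sign_vec_def vec_eq_iff)
  moreover have "sign_vec T $ i = 1 \<or> sign_vec T $ i = - 1" for T and i :: 'n
    by (simp add: sign_vec_def)
  ultimately show ?thesis
    by blast
qed

lemma num_compact_components_signs:
  "num_compact_components
     (zero_locus (invariant_quartic (- 2, 1, - 2, real CARD('n)) :: 'n::{finite,linorder} polynomial)) =
     2 ^ CARD('n)"
proof -
  have "{C \<in> components (range (sign_vec :: 'n set \<Rightarrow> _)). compact C} =
      (\<lambda>T. {sign_vec T}) ` UNIV"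
    by (auto simp: components_finite)
  moreover have "inj (\<lambda>T :: 'n set. {sign_vec T})"
    using inj_sign_vec by (auto simp: inj_def)
  ultimately show ?thesis
    by (simp add: num_compact_components_def zero_locus_signs ecard_def card_image card_sets
        flip: enat_two_power)
qed

section \<open>Concentric spheres\<close>

text \<open>The coefficients are those of \<open>(s - 1) (s - 4)\<close> with \<open>s\<close> the
  squared norm, whence the radii 1 and 2.\<close>

lemma zero_locus_spheres:
  "zero_locus (invariant_quartic (0, 1, - 5, 4) :: 'n::{finite,linorder} polynomial) =
     sphere 0 1 \<union> sphere 0 2"
proof -
  have "peval (invariant_quartic (0, 1, - 5, 4)) x = ((norm x)\<^sup>2 - 1\<^sup>2) * ((norm x)\<^sup>2 - 2\<^sup>2)"
    for x :: "(real, 'n) vec"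
    unfolding peval_invariant_quartic psum_2_eq_norm by (simp add: algebra_simps power2_eq_square)
  moreover have "(norm x)\<^sup>2 = 1\<^sup>2 \<longleftrightarrow> norm x = 1" "(norm x)\<^sup>2 = 2\<^sup>2 \<longleftrightarrow> norm x = 2"
    for x :: "(real, 'n) vec"
    by (subst power2_eq_iff_nonneg; simp)+
  ultimately show ?thesis
    by (auto simp: zero_locus_def)
qed

lemma components_two_spheres:
  assumes "2 \<le> DIM('a::euclidean_space)"
  shows "components (sphere (0::'a) 1 \<union> sphere 0 2) = {sphere 0 1, sphere 0 2}"
proof (rule components_eq_open_partition)
  let ?Z = "sphere (0::'a) 1 \<union> sphere 0 2"
  have "sphere (0::'a) 1 = ?Z \<inter> ball 0 (3/2)" "sphere (0::'a) 2 = ?Z \<inter> - cball 0 (3/2)"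
    by auto
  then have "openin (top_of_set ?Z) (sphere 0 1)" "openin (top_of_set ?Z) (sphere 0 2)"
    by (metis openin_open open_ball, metis openin_open open_Compl closed_cball)
  then show "A \<noteq> {} \<and> connected A \<and> openin (top_of_set ?Z) A" if "A \<in> {sphere 0 1, sphere 0 2}" for A
    using that assms connected_sphere by auto
qed (auto simp: pairwise_def disjnt_def)

text \<open>A nested family cannot outnumber the components, and the two spheres themselves attain
  this bound.\<close>

lemma num_nested_components_two_spheres:
  assumes "2 \<le> DIM('a::euclidean_space)"
  shows "num_nested_components (sphere (0::'a) 1 \<union> sphere 0 2) = 2"
proof -
  let ?S = "{sphere (0::'a) 1, sphere 0 2}"
  have ne: "sphere (0::'a) 1 \<noteq> sphere 0 2"
  proof -
    obtain x :: 'a where "norm x = 1" using vector_choose_size [of 1] by auto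
    then have "x \<in> sphere 0 1" "x \<notin> sphere 0 2" by auto
    then show ?thesis by blast
  qed
  then have two: "ecard ?S = 2"
    by (simp add: ecard_def numeral_eq_enat)
  have "ecard N \<le> 2" if "nested_components (sphere (0::'a) 1 \<union> sphere 0 2) N" for N
  proof -
    have "N \<subseteq> ?S"
      using that assms by (simp add: nested_components_def components_two_spheres)
    then have "finite N" "card N \<le> card ?S"
      by (auto intro: finite_subset card_mono)
    with ne show ?thesis
      by (simp add: ecard_def numeral_eq_enat)
  qed
  moreover have "nested_components (sphere (0::'a) 1 \<union> sphere 0 2) ?S"
  proof -
    \<comment> \<open>The components are already concentric spheres, so their own radii and the
      identity map give the matching.\<close>
    define \<rho> where "\<rho> C = (if C = sphere (0::'a) 1 then 1 else 2 :: real)" for C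
    have \<rho>: "\<rho> (sphere 0 1) = 1" "\<rho> (sphere 0 2) = 2"
      using ne by (auto simp: \<rho>_def)
    \<comment> \<open>\<open>cball 0 0\<close> is the origin alone; \<open>cball 0 1\<close> holds
      both the origin and the smaller sphere.\<close>
    have ins: "cball (0::'a) 0 \<subseteq> inside (sphere 0 1)" "cball (0::'a) 1 \<subseteq> inside (sphere 0 2)"
      by (intro cball_subset_inside_sphere assms; simp)+
    then have "sphere (0::'a) 1 \<subseteq> inside (sphere 0 2)" "0 \<in> inside (sphere (0::'a) 1)"
        "0 \<in> inside (sphere (0::'a) 2)"
      by (auto simp: subset_eq)
    then show ?thesis
      unfolding nested_components_def components_two_spheres [OF assms]
      by (intro conjI exI [of _ \<rho>] exI [of _ id])
        (auto simp: \<rho> inj_on_def intro: homeomorphism_ident [unfolded id_def [symmetric]])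
  qed
  ultimately show ?thesis
    unfolding num_nested_components_def using two
    by (intro antisym SUP_least) (auto intro: SUP_upper2 [of ?S])
qed

section \<open>One sheet in every orthant\<close>

text \<open>The open orthant around \<open>sign_vec T\<close>; strictness excludes the coordinate
  hyperplanes and keeps distinct orthants disjoint.\<close>

definition orthant :: "'n::finite set \<Rightarrow> (real ^ 'n) set" where
  "orthant T = {x. \<forall>i. 0 < sign_vec T $ i * x $ i}"

definition sheet :: "'n::finite set \<Rightarrow> (real ^ 'n) set" where
  "sheet T = {x \<in> orthant T. (psum 2 x)\<^sup>2 - (real CARD('n) - 1) * psum 4 x = psum 2 x}"

lemma sign_vec_square: "sign_vec T $ i * sign_vec T $ i = 1"
  by (simp add: sign_vec_def)

lemma open_orthant: "open (orthant T)"
proof -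
  have "orthant T = (\<Inter>i. {x. 0 < sign_vec T $ i * x $ i})"
    by (auto simp: orthant_def)
  then show ?thesis
    by (auto intro!: open_INT open_Collect_less continuous_intros)
qed

lemma orthant_eqD:
  assumes "x \<in> orthant T" "x \<in> orthant U"
  shows "T = U"
proof -
  have "i \<in> T \<longleftrightarrow> i \<in> U" for i
    using assms by (auto simp: orthant_def sign_vec_def dest!: spec [of _ i] split: if_splits)
  then show ?thesis by auto
qed

text \<open>Here \<open>s = q = n\<close>, and \<open>n^2 - (n - 1) n = n\<close>. So sheets are
  nonempty and, the orthants being disjoint, pairwise different.\<close>

lemma sign_vec_in_sheet: "sign_vec T \<in> sheet T"
proof -
  have "(sign_vec T $ i)\<^sup>2 = 1" for i
    by (simp add: sign_vec_def)
  moreover from this have "(sign_vec T $ i) ^ 4 = 1" for i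
    by (metis (no_types) numeral_Bit0 power_add power2_eq_square mult_1 power4_eq_xxxx)
  ultimately show ?thesis
    by (simp add: sheet_def orthant_def sign_vec_square psum_def algebra_simps power2_eq_square)
qed

text \<open>In the coordinates \<open>x\<^sub>i\<^sup>2\<close> the radial projection of a sheet is a convex second-order cone.\<close>

lemma connected_sheet:
  assumes "CARD('n::finite) \<ge> 2"
  shows "connected (sheet (T :: 'n set))"
proof -
  define c where "c = real CARD('n) - 1"
  have "0 \<le> c" using assms by (simp add: c_def)
  define P where "P y = (psum 1 y)\<^sup>2 - c * psum 2 y" for y :: "real ^ 'n"
  define K where "K = {y :: real ^ 'n. (\<forall>i. 0 < y $ i) \<and> 0 < P y}"
  \<comment> \<open>At squared coordinates \<open>t * y\<close> the equation reads
    \<open>t^2 * P y = t * psum 1 y\<close>. Its positive solution \<open>t = psum 1 y / P y\<close>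
    picks the point on the ray through \<open>y\<close>; \<open>T\<close> fixes the signs of the
    roots.\<close>
  define \<phi> where "\<phi> y = (\<chi> i. sign_vec T $ i * sqrt (psum 1 y / P y * y $ i))" for y :: "real ^ 'n"
  have pos: "0 < psum 1 y" if "\<forall>i. 0 < y $ i" for y :: "real ^ 'n"
    using that by (auto simp: psum_def intro!: sum_pos)
  \<comment> \<open>For positive \<open>y\<close> the quadratic condition \<open>0 < P y\<close>
    compares a multiple of the norm with a linear functional, which makes it convex.\<close>
  have "K = {y. \<forall>i. 0 < y $ i} \<inter> {y. sqrt c * norm y < psum 1 y}"
  proof -
    have "0 < P y \<longleftrightarrow> sqrt c * norm y < psum 1 y" if "\<forall>i. 0 < y $ i" for y :: "real ^ 'n"
    proof -
      have "0 < P y \<longleftrightarrow> (sqrt c * norm y)\<^sup>2 < (psum 1 y)\<^sup>2"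
        using \<open>0 \<le> c\<close> by (simp add: P_def psum_2_eq_norm power_mult_distrib)
      also have "\<dots> \<longleftrightarrow> sqrt c * norm y < psum 1 y"
        using pos [OF that] by (metis less_eq_real_def power_less_imp_less_base power_strict_mono
            mult_nonneg_nonneg norm_ge_zero real_sqrt_ge_zero \<open>0 \<le> c\<close> zero_less_numeral)
      finally show ?thesis .
    qed
    then show ?thesis by (auto simp: K_def)
  qed
  moreover have "convex {y :: real ^ 'n. \<forall>i. 0 < y $ i}"
  proof (rule convexI)
    fix x y :: "real ^ 'n" and u v :: real
    assume "x \<in> {y. \<forall>i. 0 < y $ i}" "y \<in> {y. \<forall>i. 0 < y $ i}" "0 \<le> u" "0 \<le> v" "u + v = 1"
    then show "u *\<^sub>R x + v *\<^sub>R y \<in> {y. \<forall>i. 0 < y $ i}"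
      by (cases "u = 0") (auto intro!: add_pos_nonneg mult_nonneg_nonneg intro: less_imp_le)
  qed
  moreover have "convex {y :: real ^ 'n. sqrt c * norm y < psum 1 y}"
  proof (rule convexI)
    fix x y :: "real ^ 'n" and u v :: real
    assume *: "x \<in> {y. sqrt c * norm y < psum 1 y}" "y \<in> {y. sqrt c * norm y < psum 1 y}"
      and uv: "0 \<le> u" "0 \<le> v" "u + v = 1"
    have "sqrt c * norm (u *\<^sub>R x + v *\<^sub>R y) \<le> sqrt c * (u * norm x + v * norm y)"
      using uv \<open>0 \<le> c\<close> norm_triangle_ineq [of "u *\<^sub>R x" "v *\<^sub>R y"]
      by (intro mult_left_mono) auto
    also have "\<dots> = u * (sqrt c * norm x) + v * (sqrt c * norm y)"
      by (simp add: algebra_simps)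
    also have "\<dots> < u * psum 1 x + v * psum 1 y"
    \<comment> \<open>Strictness comes from the first summand, whose weight is positive unless
      \<open>u = 0\<close>; then \<open>v = 1\<close>.\<close>
    proof (cases "u = 0")
      case False
      with uv * show ?thesis
        by (intro add_less_le_mono mult_strict_left_mono mult_left_mono) auto
    qed (use uv * in auto)
    also have "\<dots> = psum 1 (u *\<^sub>R x + v *\<^sub>R y)"
      by (simp add: psum_def sum.distrib sum_distrib_left)
    finally show "u *\<^sub>R x + v *\<^sub>R y \<in> {y. sqrt c * norm y < psum 1 y}" by simp
  qed
  ultimately have "connected K"
    by (simp add: convex_connected convex_Int)
  moreover have "continuous_on K \<phi>"
    unfolding \<phi>_def P_def psum_def
    by (intro continuous_intros) (auto simp: K_def P_def psum_def)
  moreover have "\<phi> ` K = sheet T"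
  proof (intro equalityI subsetI)
    fix x assume "x \<in> \<phi> ` K"
    then obtain y where y: "\<And>i. 0 < y $ i" "0 < P y" and x: "x = \<phi> y"
      by (auto simp: K_def)
    define t where "t = psum 1 y / P y"
    have "0 < t" using pos y by (simp add: t_def)
    have xi: "x $ i = sign_vec T $ i * sqrt (t * y $ i)" for i
      by (simp add: x \<phi>_def t_def)
    have sgn: "(sign_vec T $ i)\<^sup>2 = 1" for i
      by (simp add: sign_vec_def)
    have x2: "(x $ i)\<^sup>2 = t * y $ i" for i
      using y(1) [of i] \<open>0 < t\<close> by (simp add: xi power_mult_distrib sgn)
    have x4: "(x $ i) ^ 4 = t\<^sup>2 * (y $ i)\<^sup>2" for i
      using x2 [of i] by (metis power_mult_distrib power_mult numeral_Bit0 mult_2)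
    have "psum 2 x = t * psum 1 y" "psum 4 x = t\<^sup>2 * psum 2 y"
      by (simp_all add: psum_def x2 x4 sum_distrib_left)
    then have "(psum 2 x)\<^sup>2 - c * psum 4 x = t\<^sup>2 * P y"
      by (simp add: P_def algebra_simps power2_eq_square)
    \<comment> \<open>By the choice of \<open>t\<close>, \<open>t * P y = psum 1 y\<close>.\<close>
    also have "\<dots> = psum 2 x"
      using y(2) \<open>psum 2 x = t * psum 1 y\<close> by (simp add: t_def power2_eq_square)
    finally have "(psum 2 x)\<^sup>2 - c * psum 4 x = psum 2 x" .
    moreover have "0 < sign_vec T $ i * x $ i" for i
      using y(1) [of i] \<open>0 < t\<close>
      by (simp add: xi sign_vec_square flip: mult.assoc)
    ultimately show "x \<in> sheet T"
      by (simp add: sheet_def orthant_def c_def)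
  next
    fix x assume "x \<in> sheet T"
    then have x: "\<And>i. 0 < sign_vec T $ i * x $ i" "(psum 2 x)\<^sup>2 - c * psum 4 x = psum 2 x"
      by (auto simp: sheet_def orthant_def c_def)
    \<comment> \<open>For the squared coordinates of a point of the sheet the equation says
      \<open>P y = psum 1 y\<close>. The scaling factor is therefore 1, and \<open>\<phi>\<close>
      returns the point itself.\<close>
    define y where "y = (\<chi> i. (x $ i)\<^sup>2)"
    have x0: "x $ i \<noteq> 0" for i
      using x(1) [of i] by auto
    then have y: "0 < y $ i" for i by (simp add: y_def)
    have "psum 1 y = psum 2 x" "psum 2 y = psum 4 x"
      by (simp_all add: y_def psum_def flip: power_mult)
    then have P: "P y = psum 1 y"
      using x(2) by (simp add: P_def)
    moreover have "x $ i = sign_vec T $ i * \<bar>x $ i\<bar>" for i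
      using x(1) [of i] by (auto simp: sign_vec_def split: if_splits)
    ultimately have "x = \<phi> y"
      using pos y by (simp add: \<phi>_def vec_eq_iff less_imp_neq [THEN not_sym]) (simp add: y_def)
    moreover have "y \<in> K"
      using y pos P by (simp add: K_def)
    ultimately show "x \<in> \<phi> ` K" by blast
  qed
  ultimately show ?thesis
    by (metis connected_continuous_image)
qed

text \<open>The choice of \<open>A\<close> and \<open>B\<close> makes
  \<open>A (s^2 - q) / 2 + B s^2\<close> equal to \<open>s^2 - (n - 1) q\<close>. It remains to see
  that a nonzero solution has no vanishing coordinate.\<close>

lemma zero_locus_sheets:
  assumes "CARD('n::{finite,linorder}) \<ge> 2"
  shows "zero_locus (invariant_quartic (2 * (real CARD('n) - 1), 2 - real CARD('n), - 1, 0) :: 'n polynomial) =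
    insert 0 (\<Union>T. sheet T)"
proof -
  let ?c = "real CARD('n) - 1"
  have Z: "x \<in> zero_locus (invariant_quartic (2 * ?c, 2 - real CARD('n), - 1, 0)) \<longleftrightarrow>
      (psum 2 x)\<^sup>2 - ?c * psum 4 x = psum 2 x" for x :: "(real, 'n) vec"
    unfolding zero_locus_def peval_invariant_quartic mem_Collect_eq
    by (simp add: field_simps) linarith
  moreover have "\<exists>T. x \<in> orthant T" if x: "(psum 2 x)\<^sup>2 - ?c * psum 4 x = psum 2 x" "x \<noteq> 0" for x :: "(real, 'n) vec"
  proof -
    have "x $ i \<noteq> 0" for i
    proof
      assume "x $ i = 0"
      \<comment> \<open>The exponent must be positive because \<open>0 ^ 0 = 1\<close>.\<close>
      then have *: "psum k x = (\<Sum>j\<in>UNIV - {i}. (x $ j) ^ k)" if "0 < k" for k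
        using that unfolding psum_def by (simp add: sum.remove [of UNIV i])
      \<comment> \<open>Cauchy-Schwarz over the \<open>n - 1\<close> remaining coordinates yields
        exactly the factor \<open>n - 1\<close> of the equation.\<close>
      have "(psum 2 x)\<^sup>2 \<le> real (card (UNIV - {i})) * psum 4 x"
        using sum_squared_le_sum_of_squares [of "\<lambda>j. (x $ j)\<^sup>2" "UNIV - {i}"]
        by (simp add: * mult.commute flip: power_mult)
      with x(1) have "psum 2 x \<le> 0"
        by (simp add: card_Diff_singleton of_nat_diff)
      with x(2) show False
        by (simp add: psum_2_eq_norm)
    qed
    then have "x \<in> orthant {i. 0 < x $ i}"
      by (auto simp: orthant_def sign_vec_def linorder_neq_iff)
    then show ?thesis ..
  qed
  ultimately show ?thesis
    unfolding set_eq_iff insert_iff Z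
    by (auto simp: sheet_def psum_2_eq_norm) (simp add: psum_def)
qed

text \<open>The origin and the sheets are connected, relatively open blocks: one for each set of
  coordinates and one more for the origin.\<close>

lemma num_components_sheets:
  assumes "CARD('n::{finite,linorder}) \<ge> 2"
  shows "num_components (zero_locus
    (invariant_quartic (2 * (real CARD('n) - 1), 2 - real CARD('n), - 1, 0) :: 'n polynomial)) =
    2 ^ CARD('n) + 1"
proof -
  let ?Z = "insert 0 (\<Union>T :: 'n set. sheet T)" and ?F = "insert {0} (range (sheet :: 'n set \<Rightarrow> _))"
  have inj: "inj (sheet :: 'n set \<Rightarrow> _)"
    by (rule injI) (metis (mono_tags) mem_Collect_eq orthant_eqD sheet_def sign_vec_in_sheet)
  have not_0: "0 \<notin> sheet T" for T :: "'n set"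
    by (simp add: sheet_def orthant_def)
  have "components ?Z = ?F"
  proof (rule components_eq_open_partition)
    \<comment> \<open>As \<open>q\<close> is nonnegative, the equation gives
      \<open>s \<le> s^2\<close>, so \<open>1 \<le> s\<close> for nonzero \<open>x\<close>. The open
      unit ball thus isolates the origin.\<close>
    have "1 \<le> norm x" if "x \<in> sheet T" for x :: "(real, 'n) vec" and T
    proof -
      have "x \<noteq> 0" using that not_0 by auto
      have "0 \<le> (real CARD('n) - 1) * psum 4 x"
        by (auto simp: psum_def intro!: mult_nonneg_nonneg sum_nonneg)
      then have "psum 2 x \<le> (psum 2 x)\<^sup>2"
        using that by (simp add: sheet_def)
      with \<open>x \<noteq> 0\<close> have "1 \<le> (norm x)\<^sup>2"
        by (simp add: psum_2_eq_norm power2_eq_square)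
      then show ?thesis
        by (simp add: abs_le_square_iff [of 1 "norm x", simplified])
    qed
    then have "{0} = ?Z \<inter> ball 0 1"
      by force
    then have zero: "openin (top_of_set ?Z) {0}"
      by (metis openin_open open_ball)
    have "sheet T = ?Z \<inter> orthant T" for T :: "'n set"
    proof -
      have "0 \<notin> orthant T" by (simp add: orthant_def)
      then show ?thesis by (auto simp: sheet_def dest: orthant_eqD)
    qed
    then have "openin (top_of_set ?Z) (sheet T)" for T :: "'n set"
      by (metis openin_open open_orthant)
    with zero show "A \<noteq> {} \<and> connected A \<and> openin (top_of_set ?Z) A" if "A \<in> ?F" for A
      using that sign_vec_in_sheet connected_sheet [OF assms] by fastforce
    have "disjnt (sheet T) (sheet U)" if "T \<noteq> U" for T U :: "'n set"
      using that by (auto simp: disjnt_def sheet_def dest: orthant_eqD)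
    then show "pairwise disjnt ?F"
      using not_0 by (intro pairwiseI) (elim insertE rangeE; simp; metis)
  qed auto
  moreover have "card ?F = 2 ^ CARD('n) + 1"
  proof -
    have "{0} \<notin> range (sheet :: 'n set \<Rightarrow> _)"
      using not_0 by force
    then show ?thesis
      using inj by (simp add: card_image card_sets)
  qed
  ultimately show ?thesis
    unfolding num_components_def zero_locus_sheets [OF assms]
    by (simp add: ecard_def one_enat_def flip: enat_two_power)
qed

section \<open>The three coefficient vectors together\<close>

theorem theorem1:
  fixes f :: "real \<times> real \<times> real \<times> real \<Rightarrow> 'n::{finite,linorder} polynomial"
  assumes n: "CARD('n) \<ge> 2"
    and f: "\<And>A B C D. f (A, B, C, D) =
              Const A * sigma2 + Const B * sigma1 ^ 2 + Const C * sigma1 + Const D"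
  shows "\<exists>S1 S2 S3.
      S1 \<noteq> {} \<and> S2 \<noteq> {} \<and> S3 \<noteq> {} \<and>
      geometric_characteristic f S1 \<and>
      geometric_characteristic f S2 \<and>
      geometric_characteristic f S3 \<and>
      (\<forall>p\<in>S1 \<union> S2 \<union> S3. CB_invariant (f p) \<and> total_degree (f p) = 4) \<and>
      is_maximum_on (\<lambda>p. num_components (zero_locus (f p))) S1 (2 ^ CARD('n) + 1) \<and>
      is_maximum_on (\<lambda>p. num_compact_components (zero_locus (f p))) S2 (2 ^ CARD('n)) \<and>
      is_maximum_on (\<lambda>p. num_nested_components (zero_locus (f p))) S3 2"
proof -
  have f_eq: "f = invariant_quartic"
    using f by (auto simp: invariant_quartic_def)
  define p1 where "p1 = (2 * (real CARD('n) - 1), 2 - real CARD('n), - 1 :: real, 0 :: real)"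
  define p2 where "p2 = (- 2 :: real, 1 :: real, - 2 :: real, real CARD('n))"
  define p3 where "p3 = (0 :: real, 1 :: real, - 5 :: real, 4 :: real)"
  \<comment> \<open>For \<open>c = n\<close> the left side is the quartic part for \<open>p1\<close>
    at the all-ones vector, where \<open>s = q = n\<close>. On a coordinate axis that part is only
    \<open>2 - n\<close>, which vanishes for \<open>n = 2\<close>.\<close>
  have cubic: "2 * (c - 1) * (c\<^sup>2 - c) / 2 + (2 - c) * c\<^sup>2 = c" for c :: real
    by (simp add: field_simps power2_eq_square)
  \<comment> \<open>On an axis \<open>s = q = 1\<close>, so the quartic part reduces to
    \<open>B\<close>, which is 1 for \<open>p2\<close> and \<open>p3\<close>.\<close>
  have axis: "psum k (axis i 1 :: (real, 'n) vec) = 1" if "0 < k" for k i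
  proof -
    have "(axis i 1 $ j :: real) ^ k = (if j = i then 1 else 0)" for j
      using that by (simp add: axis_def)
    then show ?thesis by (simp add: psum_def)
  qed
  have "total_degree (f p1) = 4"
    unfolding f_eq p1_def
    by (rule total_degree_invariant_quartic [of _ "\<chi> i. 1"])
      (use cubic [of "real CARD('n)"] in \<open>simp add: psum_def\<close>)
  moreover have "total_degree (f p2) = 4" "total_degree (f p3) = 4"
    unfolding f_eq p2_def p3_def
    by (rule total_degree_invariant_quartic [of _ "axis undefined 1"]; simp add: axis)+
  ultimately have "\<forall>p\<in>{p1} \<union> {p2} \<union> {p3}. CB_invariant (f p) \<and> total_degree (f p) = 4"
    by (simp add: f_eq CB_invariant_invariant_quartic)
  moreover have "num_components (zero_locus (f p1)) = 2 ^ CARD('n) + 1"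
    using num_components_sheets [OF n] by (simp add: f_eq p1_def)
  moreover have "num_compact_components (zero_locus (f p2)) = 2 ^ CARD('n)"
    using num_compact_components_signs by (simp add: f_eq p2_def)
  moreover have "num_nested_components (zero_locus (f p3)) = 2"
    using num_nested_components_two_spheres [where 'a = "(real, 'n) vec"] n
    by (simp add: f_eq p3_def zero_locus_spheres)
  ultimately show ?thesis
    by (intro exI [of _ "{p1}"] exI [of _ "{p2}"] exI [of _ "{p3}"])
      (simp add: geometric_characteristic_singleton is_maximum_on_def)
qed

end
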